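(* EVA is a polynomial-time algorithm: on every instance of the user-association problem (P1), the number of elementary operations performed by EVA is bounded by a polynomial in the size of the instance.
   Context: Setting. $\mathcal{M},\mathcal{S},\mathcal{E}$ are finite nonempty sets of users, small cells and enhanced views. $R_{i,j}>0$ is the data rate from cell $j$ to user $i$, $B$ the size of the basic view, $E_k$ the size of enhanced view $k$; $N^b_{i,j}=\lceil B/R_{i,j}\rceil$, $N^e_{i,j,k}=\lceil E_k/R_{i,j}\rceil$; $N_j$ is the number of resource blocks of cell $j$; $w_{i,j,k}\in\{0,1\}$ indicates whether enhanced view $k$ desired by user $i$ is stored in cell $j$, subject to the cache constraint $\sum_{k}(1-\prod_{i}(1-w_{i,j,k}))\le K$ for every $j$. Problem (P1): maximize $\sum_{i,j,k}y_{i,j,k}w_{i,j,k}$ over $x_{i,j}\in\{0,1\}$, $y_{i,j,k}\in[0,1]$ subject to $\sum_j x_{i,j}=1$ for all $i$; $y_{i,j,k}\le x_{i,j}w_{i,j,k}$ for all $i,j,k$; and $\max_{i}\{x_{i,j}N^b_{i,j}\}+\sum_{i,k}y_{i,j,k}N^e_{i,j,k}\le N_j$ for all $j$. Algorithm EVA. Let $A_{i,j}=\bigl(\sum_{k\in\mathcal{E}}w_{i,j,k}\bigr)^p/N^b_{i,j}$, where $p$ is a fixed parameter. Initialize $x=0$, $y=0$, $\check N^b_j=0$. For each user $i$, rank the cells $j\in\mathcal{S}$ by $A_{i,j}$ in descending order, set $x_{i,j}=1$ for the cell $j$ with the highest $A_{i,j}$, and replace $\check N^b_j$ by $\max\{N^b_{i,j}x_{i,j},\check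 N^b_j\}$. Then for each $j$ replace $N_j$ by $N_j-\check N^b_j$. Then for each user $i$, with $j$ its associated cell, go through $k\in\mathcal{E}$ in descending order of $w_{i,j,k}/N^e_{i,j,k}$, set $y_{i,j,k}=\min\{N_j/N^e_{i,j,k},1\}$ and replace $N_j$ by $N_j-y_{i,j,k}N^e_{i,j,k}$. Output $(x,y)$. *)

theory Defs
  imports Complex_Main "HOL-Computational_Algebra.Polynomial"
begin

section \<open>A real random access machine with unit-cost operations\<close>

text \<open>
  The store consists of arrays of real numbers, addressed by an array name and a list of
  indices; a scalar is an array without indices. Expressions and commands are syntactic
  objects, so the number of elementary operations is fixed by the semantics below, and not
  by annotations inside a particular program.
\<close>

type_synonym store = "string \<times> nat list \<Rightarrow> real"

datatype binop = Add | Sub | Mul | Div | Min | Max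

datatype exp =
    Lit real
  | Ref string "exp list" (infix "\<cdot>" 90)
  | Bin binop exp exp
  | Ceil exp
  | Pow exp real

abbreviation add_exp (infixl "\<oplus>" 65) where "a \<oplus> b \<equiv> Bin Add a b"
abbreviation sub_exp (infixl "\<ominus>" 65) where "a \<ominus> b \<equiv> Bin Sub a b"
abbreviation mul_exp (infixl "\<otimes>" 70) where "a \<otimes> b \<equiv> Bin Mul a b"
abbreviation div_exp (infixl "\<oslash>" 70) where "a \<oslash> b \<equiv> Bin Div a b"

datatype com =
    Assign string "exp list" exp  ("(_\<cdot>_ ::=/ _)" [91, 91, 61] 61)
  | Seq com com                   (infixr ";;" 60)
  | Cond exp exp com              ("(IF _ \<prec> _/ THEN _/ FI)")
  | For string exp com            ("(FOR _ BELOW _/ DO _/ OD)")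

fun apply_binop :: "binop \<Rightarrow> real \<Rightarrow> real \<Rightarrow> real" where
  "apply_binop Add a b = a + b"
| "apply_binop Sub a b = a - b"
| "apply_binop Mul a b = a * b"
| "apply_binop Div a b = a / b"
| "apply_binop Min a b = min a b"
| "apply_binop Max a b = max a b"

text \<open>Unlike \<open>powr\<close>, this satisfies \<open>0\<^sup>0 = 1\<close>.\<close>

definition real_pow :: "real \<Rightarrow> real \<Rightarrow> real" where
  "real_pow a r = (if r = 0 then 1 else a powr r)"

fun eval :: "exp \<Rightarrow> store \<Rightarrow> real" where
  "eval (Lit c) s = c"
| "eval (a\<cdot>ix) s = s (a, map (\<lambda>e. nat \<lfloor>eval e s\<rfloor>) ix)"
| "eval (Bin f e1 e2) s = apply_binop f (eval e1 s) (eval e2 s)"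
| "eval (Ceil e) s = of_int \<lceil>eval e s\<rceil>"
| "eval (Pow e r) s = real_pow (eval e s) r"

text \<open>Every constant, every array access and every arithmetic operation costs one unit.\<close>

fun exp_ops :: "exp \<Rightarrow> nat" where
  "exp_ops (Lit c) = 1"
| "exp_ops (a\<cdot>ix) = 1 + sum_list (map exp_ops ix)"
| "exp_ops (Bin f e1 e2) = 1 + exp_ops e1 + exp_ops e2"
| "exp_ops (Ceil e) = 1 + exp_ops e"
| "exp_ops (Pow e r) = 1 + exp_ops e"

text \<open>
  \<open>exec c s\<close> is the final store together with the number of elementary operations performed.
  A comparison or a write costs one unit. The bound of a loop is evaluated once, on entry;
  initializing the loop counter costs one unit, and each iteration costs two units for
  incrementing and testing the counter, in addition to the operations of the loop body.
\<close>

primrec exec :: "com \<Rightarrow> store \<Rightarrow> store \<times> nat" where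
  "exec (a\<cdot>ix ::= e) s =
     (s((a, map (\<lambda>e. nat \<lfloor>eval e s\<rfloor>) ix) := eval e s),
      1 + sum_list (map exp_ops ix) + exp_ops e)"
| "exec (c1 ;; c2) s =
     (let (s1, n1) = exec c1 s; (s2, n2) = exec c2 s1 in (s2, n1 + n2))"
| "exec (IF e1 \<prec> e2 THEN c FI) s =
     (let n0 = 1 + exp_ops e1 + exp_ops e2 in
      if eval e1 s < eval e2 s then (let (s1, n1) = exec c s in (s1, n0 + n1)) else (s, n0))"
| "exec (FOR v BELOW b DO c OD) s =
     fold (\<lambda>i (s, n). let (s', n') = exec c (s((v, []) := real i)) in (s', n + 2 + n'))
       [0..<nat \<lfloor>eval b s\<rfloor>] (s, 1 + exp_ops b)"


section \<open>Instances of the user-association problem\<close>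

text \<open>
  Users, small cells and enhanced views are numbered from \<open>0\<close>; the functions are only relevant
  for arguments within these ranges.
\<close>

record P1_instance =
  users :: nat
  cells :: nat
  views :: nat
  rate :: "nat \<Rightarrow> nat \<Rightarrow> real"
  basic_size :: real
  enh_size :: "nat \<Rightarrow> real"
  blocks :: "nat \<Rightarrow> nat"
  stored :: "nat \<Rightarrow> nat \<Rightarrow> nat \<Rightarrow> int"
  cache :: nat

definition P1_valid :: "P1_instance \<Rightarrow> bool" where
  "P1_valid I \<longleftrightarrow>
     users I > 0 \<and> cells I > 0 \<and> views I > 0 \<and>
     (\<forall>i<users I. \<forall>j<cells I. rate I i j > 0) \<and>
     (\<forall>i<users I. \<forall>j<cells I. \<forall>k<views I. stored I i j k \<in> {0, 1}) \<and>
     (\<forall>j<cells I. (\<Sum>k<views I. 1 - (\<Prod>i<users I. 1 - stored I i j k)) \<le> int (cache I))"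

text \<open>
  The size is the number of numerical data of the instance, in the order \<open>R\<close>, \<open>B\<close>, \<open>E\<close>,
  \<open>N\<close>, \<open>w\<close>, \<open>K\<close>. It is at most the length of any encoding that spends at least one symbol
  on each of these numbers.
\<close>

definition P1_size :: "P1_instance \<Rightarrow> nat" where
  "P1_size I = users I * cells I + 1 + views I + cells I + users I * cells I * views I + 1"

definition load :: "P1_instance \<Rightarrow> store" where
  "load I = (\<lambda>(a, ix). case ix of
       [] \<Rightarrow>
         if a = ''m'' then real (users I)
         else if a = ''s'' then real (cells I)
         else if a = ''e'' then real (views I)
         else if a = ''B'' then basic_size I
         else if a = ''K'' then real (cache I)
         else 0
     | [l] \<Rightarrow>
         if a = ''E'' then enh_size I l
         else if a = ''N'' then real (blocks I l)
         else 0
     | [i, j] \<Rightarrow> if a = ''R'' then rate I i j else 0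
     | [i, j, k] \<Rightarrow> if a = ''w'' then of_int (stored I i j k) else 0
     | _ \<Rightarrow> 0)"


section \<open>Algorithm EVA\<close>

text \<open>
  Stable bubble sort: \<open>rank\<close> becomes a permutation of the numbers below \<open>n\<close> along which
  \<open>key\<close> is descending, with ties in increasing order of the index.
\<close>

definition rank_descending :: "exp \<Rightarrow> com" where
  "rank_descending n = (let t = ''t''\<cdot>[]; t' = t \<oplus> Lit 1 in
     FOR ''t'' BELOW n DO ''rank''\<cdot>[t] ::= t OD ;;
     FOR ''r'' BELOW n DO
       FOR ''t'' BELOW n \<ominus> Lit 1 DO
         IF ''key''\<cdot>[''rank''\<cdot>[t]] \<prec> ''key''\<cdot>[''rank''\<cdot>[t']] THEN
           ''tmp''\<cdot>[] ::= ''rank''\<cdot>[t] ;;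
           ''rank''\<cdot>[t] ::= ''rank''\<cdot>[t'] ;;
           ''rank''\<cdot>[t'] ::= ''tmp''\<cdot>[]
         FI
       OD
     OD)"

text \<open>
  The scalars \<open>m\<close>, \<open>s\<close>, \<open>e\<close> hold the numbers of users, cells and views. The arrays \<open>Nb\<close>,
  \<open>Ne\<close> and \<open>Nc\<close> hold \<open>N\<^sup>b\<close>, \<open>N\<^sup>e\<close> and the \<open>N\<close> with the check mark; \<open>assoc\<close> holds the cell
  of each user. The output is left in the arrays \<open>x\<close> and \<open>y\<close>.
\<close>

definition EVA :: "real \<Rightarrow> com" where
  "EVA p = (let
     m = ''m''\<cdot>[]; s = ''s''\<cdot>[]; e = ''e''\<cdot>[];
     i = ''i''\<cdot>[]; j = ''j''\<cdot>[]; k = ''k''\<cdot>[];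
     B = ''B''\<cdot>[]; E = (\<lambda>k. ''E''\<cdot>[k]); R = (\<lambda>i j. ''R''\<cdot>[i, j]); w = (\<lambda>i j k. ''w''\<cdot>[i, j, k]);
     N = (\<lambda>j. ''N''\<cdot>[j]); Nc = (\<lambda>j. ''Nc''\<cdot>[j]);
     Nb = (\<lambda>i j. ''Nb''\<cdot>[i, j]); Ne = (\<lambda>i j k. ''Ne''\<cdot>[i, j, k]);
     A = (\<lambda>i j. ''A''\<cdot>[i, j]); x = (\<lambda>i j. ''x''\<cdot>[i, j]); y = (\<lambda>i j k. ''y''\<cdot>[i, j, k])
   in
     FOR ''i'' BELOW m DO
       FOR ''j'' BELOW s DO
         ''Nb''\<cdot>[i, j] ::= Ceil (B \<oslash> R i j) ;;
         ''sum''\<cdot>[] ::= Lit 0 ;;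
         FOR ''k'' BELOW e DO
           ''Ne''\<cdot>[i, j, k] ::= Ceil (E k \<oslash> R i j) ;;
           ''sum''\<cdot>[] ::= ''sum''\<cdot>[] \<oplus> w i j k
         OD ;;
         ''A''\<cdot>[i, j] ::= Pow (''sum''\<cdot>[]) p \<oslash> Nb i j
       OD
     OD ;;
     FOR ''j'' BELOW s DO
       ''Nc''\<cdot>[j] ::= Lit 0 ;;
       FOR ''i'' BELOW m DO
         ''x''\<cdot>[i, j] ::= Lit 0 ;;
         FOR ''k'' BELOW e DO ''y''\<cdot>[i, j, k] ::= Lit 0 OD
       OD
     OD ;;
     FOR ''i'' BELOW m DO
       FOR ''j'' BELOW s DO ''key''\<cdot>[j] ::= A i j OD ;;
       rank_descending s ;;
       ''j''\<cdot>[] ::= ''rank''\<cdot>[Lit 0] ;;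
       ''assoc''\<cdot>[i] ::= j ;;
       ''x''\<cdot>[i, j] ::= Lit 1 ;;
       ''Nc''\<cdot>[j] ::= Bin Max (Nb i j \<otimes> x i j) (Nc j)
     OD ;;
     FOR ''j'' BELOW s DO ''N''\<cdot>[j] ::= N j \<ominus> Nc j OD ;;
     FOR ''i'' BELOW m DO
       ''j''\<cdot>[] ::= ''assoc''\<cdot>[i] ;;
       FOR ''k'' BELOW e DO ''key''\<cdot>[k] ::= w i j k \<oslash> Ne i j k OD ;;
       rank_descending e ;;
       FOR ''l'' BELOW e DO
         ''k''\<cdot>[] ::= ''rank''\<cdot>[''l''\<cdot>[]] ;;
         ''y''\<cdot>[i, j, k] ::= Bin Min (N j \<oslash> Ne i j k) (Lit 1) ;;
         ''N''\<cdot>[j] ::= N j \<ominus> y i j k \<otimes> Ne i j k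
       OD
     OD)"

definition EVA_operations :: "real \<Rightarrow> P1_instance \<Rightarrow> nat" where
  "EVA_operations p I = snd (exec (EVA p) (load I))"

end

theory Submission
  imports Defs
begin

text \<open>
  Every loop of EVA is bounded by one of the scalars \<open>m\<close>, \<open>s\<close>, \<open>e\<close>, possibly minus one, and
  EVA never writes to these. For every program of this form, replacing each loop bound by an
  indeterminate yields a polynomial in any common bound on the scalars that dominates the
  number of operations.
\<close>

primrec scalar_loops :: "string set \<Rightarrow> com \<Rightarrow> bool" where
  "scalar_loops X (a\<cdot>ix ::= e) \<longleftrightarrow> a \<notin> X"
| "scalar_loops X (c1 ;; c2) \<longleftrightarrow> scalar_loops X c1 \<and> scalar_loops X c2"
| "scalar_loops X (IF e1 \<prec> e2 THEN c FI) \<longleftrightarrow> scalar_loops X c"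
| "scalar_loops X (FOR v BELOW b DO c OD) \<longleftrightarrow>
     v \<notin> X \<and> (\<exists>a\<in>X. b = a\<cdot>[] \<or> b = a\<cdot>[] \<ominus> Lit 1) \<and> scalar_loops X c"

text \<open>The indeterminate stands for the iteration count of every loop, and the body of a
  conditional is always charged. Natural coefficients make evaluation monotone, so nested
  overestimates compose.\<close>

primrec ops_poly :: "com \<Rightarrow> nat poly" where
  "ops_poly (a\<cdot>ix ::= e) = [:1 + sum_list (map exp_ops ix) + exp_ops e:]"
| "ops_poly (c1 ;; c2) = ops_poly c1 + ops_poly c2"
| "ops_poly (IF e1 \<prec> e2 THEN c FI) = [:1 + exp_ops e1 + exp_ops e2:] + ops_poly c"
| "ops_poly (FOR v BELOW b DO c OD) = [:1 + exp_ops b:] + [:0, 1:] * ([:2:] + ops_poly c)"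

text \<open>The fold is the one in the semantics of \<open>FOR\<close>. The cost bound
  \<open>C\<close> is available only in stores satisfying \<open>P\<close>, so \<open>P\<close> is
  carried along; the arbitrary start \<open>n\<close> serves the induction.\<close>

lemma fold_cost_le:
  assumes step: "\<And>i s. P s \<Longrightarrow> P (fst (f i s)) \<and> snd (f i s) \<le> C"
    and "P s"
  shows "P (fst (fold (\<lambda>i (s, n). let (s', n') = f i s in (s', n + 2 + n')) xs (s, n))) \<and>
         snd (fold (\<lambda>i (s, n). let (s', n') = f i s in (s', n + 2 + n')) xs (s, n))
           \<le> n + length xs * (2 + C)"
  using \<open>P s\<close>
proof (induction xs arbitrary: s n)
  case Nil
  then show ?case by simp
next
  case (Cons x xs)
  obtain s' n' where eq: "f x s = (s', n')" by fastforce
  with step[OF Cons.prems, of x] have "P s'" "n' \<le> C" by auto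
  with Cons.IH[of s' "n + 2 + n'"] show ?case
    by (simp add: eq)
qed

text \<open>Both claims go through one induction: a later command runs in the store left by an
  earlier one, where its loop bounds must still be at most \<open>D\<close>.\<close>

lemma exec_ops_le:
  assumes "scalar_loops X c" and "\<forall>a\<in>X. s (a, []) \<le> real D"
  shows "(\<forall>a\<in>X. fst (exec c s) (a, []) \<le> real D) \<and> snd (exec c s) \<le> poly (ops_poly c) D"
  using assms
proof (induction c arbitrary: s)
  case (Assign a ix e)
  then show ?case by auto
next
  case (Seq c1 c2)
  obtain s1 n1 where 1: "exec c1 s = (s1, n1)" by fastforce
  obtain s2 n2 where 2: "exec c2 s1 = (s2, n2)" by fastforce
  from Seq.IH(1)[of s] Seq.IH(2)[of s1] Seq.prems show ?case
    by (simp add: 1 2)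
next
  case (Cond e1 e2 c)
  obtain s1 n1 where 1: "exec c s = (s1, n1)" by fastforce
  from Cond.IH[of s] Cond.prems show ?case
    by (simp add: 1 Let_def)
next
  case (For v b c)
  let ?P = "\<lambda>s. \<forall>a\<in>X. s (a, []) \<le> real D"
  let ?f = "\<lambda>i s. exec c (s((v, []) := real i))"
  let ?k = "nat \<lfloor>eval b s\<rfloor>"
  from For.prems have "eval b s \<le> real D" by force
  then have k: "?k \<le> D" by linarith
  have "?P (fst (?f i s)) \<and> snd (?f i s) \<le> poly (ops_poly c) D" if "?P s" for i s
  proof (rule For.IH)
    \<comment> \<open>Setting the counter keeps the invariant because \<open>v\<close> is not in
      \<open>X\<close>.\<close>
    show "?P (s((v, []) := real i))" "scalar_loops X c"
      using For.prems(1) that by auto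
  qed
  note fold = fold_cost_le[of ?P ?f, OF this For.prems(2), of "[0..<?k]" "1 + exp_ops b"]
  have "?k * (2 + poly (ops_poly c) D) \<le> D * (2 + poly (ops_poly c) D)"
    using k by (rule mult_right_mono) simp
  with fold show ?case by simp
qed

lemma scalar_loops_EVA: "scalar_loops {''m'', ''s'', ''e''} (EVA p)"
  by (simp add: EVA_def rank_descending_def Let_def)

lemma load_scalars_le_size:
  assumes "P1_valid I" and "a \<in> {''m'', ''s'', ''e''}"
  shows "load I (a, []) \<le> real (P1_size I)"
proof -
  \<comment> \<open>The size contains \<open>users I\<close> only within products, so
    \<open>cells I > 0\<close> is used here.\<close>
  from assms(1) have "users I \<le> users I * cells I" by (simp add: P1_valid_def)
  then have "users I \<le> P1_size I" "cells I \<le> P1_size I" "views I \<le> P1_size I"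
    unfolding P1_size_def by linarith+
  with assms(2) show ?thesis by (auto simp: load_def)
qed

theorem lemma8:
  fixes p :: real
  shows "\<exists>q :: nat poly. \<forall>I. P1_valid I \<longrightarrow> EVA_operations p I \<le> poly q (P1_size I)"
proof (intro exI allI impI)
  fix I
  assume "P1_valid I"
  \<comment> \<open>The witness is read off the program text and hence does not depend on
    \<open>I\<close>.\<close>
  then show "EVA_operations p I \<le> poly (ops_poly (EVA p)) (P1_size I)"
    unfolding EVA_operations_def
    using exec_ops_le[OF scalar_loops_EVA] load_scalars_le_size by blast
qed

end
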